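(* There is a constant $C>0$ such that for all positive integers $n$ and $\ell$ the polytope $\mathrm{P}_{\mathrm{match}}^{\ell}(n)$ has an extension of size at most $2^{C\ell}\,n^2\log n$ for which, moreover, the encoding lengths of the coefficients needed to describe it (i.e., of the coefficients of a system of linear equations and inequalities defining the extension polyhedron and of the projection) are bounded by $C$.
   Context: $K_n=([n],E_n)$ is the complete graph on $[n]=\{1,\dots,n\}$. $\mathcal{M}^{\ell}(n)$ is the set of all matchings $M\subseteq E_n$ (sets of edges no two of which share a node) with $|M|=\ell$; $\chi(M)\in\{0,1\}^{E_n}$ is the characteristic vector of $M$; and $\mathrm{P}_{\mathrm{match}}^{\ell}(n)=\operatorname{conv}\{\chi(M): M\in\mathcal{M}^{\ell}(n)\}\subseteq\mathbb{R}^{E_n}$ (empty if $\ell>n/2$). An extension of a polytope $P\subseteq\mathbb{R}^m$ is a polyhedron $Q\subseteq\mathbb{R}^d$ together with an affine map $p:\mathbb{R}^d\to\mathbb{R}^m$ with $p(Q)=P$. The size of the extension is the number of facets of $Q$. No symmetry is required of the extension. *)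

theory Defs
  imports "HOL-Analysis.Analysis" "HOL-Analysis.Finite_Function_Topology"
begin

text \<open>
  The dimension of an extension polyhedron is meant to be quantified over, so it
  cannot be a type. The space of real vectors indexed by a finite set \<open>I\<close> is therefore the subspace
  of \<open>'i \<Rightarrow>\<^sub>0 real\<close> (a \<open>real_vector\<close>, so that \<open>convex hull\<close>, \<open>linear\<close> and \<open>face_of\<close> apply) of all
  vectors supported in \<open>I\<close>; d-dimensional space is the case \<open>I = {..<d}\<close>.
\<close>

definition coord_space :: "'i set \<Rightarrow> ('i \<Rightarrow>\<^sub>0 real) set" where
  "coord_space I = {x. Poly_Mapping.keys x \<subseteq> I}"

definition complete_edges :: "nat \<Rightarrow> nat set set" where
  "complete_edges n = {e. e \<subseteq> {1..n} \<and> card e = 2}"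

definition matchings :: "nat \<Rightarrow> nat \<Rightarrow> nat set set set" where
  "matchings l n = {M. M \<subseteq> complete_edges n \<and> pairwise disjnt M \<and> card M = l}"

definition char_vec :: "'i set \<Rightarrow> ('i \<Rightarrow>\<^sub>0 real)" where
  "char_vec M = (\<Sum>e\<in>M. Poly_Mapping.single e 1)"

lemma lookup_char_vec:
  "finite M \<Longrightarrow> Poly_Mapping.lookup (char_vec M) e = (if e \<in> M then 1 else 0)"
  by (simp add: char_vec_def lookup_sum lookup_single when_def)

definition match_polytope :: "nat \<Rightarrow> nat \<Rightarrow> (nat set \<Rightarrow>\<^sub>0 real) set" where
  "match_polytope l n = convex hull (char_vec ` matchings l n)"

text \<open>A constraint is a pair \<open>(a, b)\<close> of coefficients and right-hand side; only the entries of
  \<open>a\<close> at indices below \<open>d\<close> matter.\<close>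

definition lin_form :: "nat \<Rightarrow> (nat \<Rightarrow> real) \<Rightarrow> (nat \<Rightarrow>\<^sub>0 real) \<Rightarrow> real" where
  "lin_form d a x = (\<Sum>i<d. a i * Poly_Mapping.lookup x i)"

definition solution_set ::
    "nat \<Rightarrow> ((nat \<Rightarrow> real) \<times> real) set \<Rightarrow> ((nat \<Rightarrow> real) \<times> real) set \<Rightarrow> (nat \<Rightarrow>\<^sub>0 real) set" where
  "solution_set d Eqs Ineqs = {x \<in> coord_space {..<d}.
     (\<forall>(a, b)\<in>Eqs. lin_form d a x = b) \<and> (\<forall>(a, b)\<in>Ineqs. lin_form d a x \<le> b)}"

definition polyhedron_in :: "nat \<Rightarrow> (nat \<Rightarrow>\<^sub>0 real) set \<Rightarrow> bool" where
  "polyhedron_in d Q \<longleftrightarrow>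
     (\<exists>Eqs Ineqs. finite Eqs \<and> finite Ineqs \<and> Q = solution_set d Eqs Ineqs)"

text \<open>\<open>aff_dim\<close> and \<open>facet_of\<close> exist in the library for Euclidean spaces only; the following two
  definitions extend them to arbitrary real vector spaces.\<close>

definition affine_dim :: "'a::real_vector set \<Rightarrow> int" where
  "affine_dim S = (if S = {} then - 1 else int (dim {x - y | x y. x \<in> S \<and> y \<in> S}))"

definition is_facet_of :: "'a::real_vector set \<Rightarrow> 'a set \<Rightarrow> bool" where
  "is_facet_of F S \<longleftrightarrow> F face_of S \<and> F \<noteq> {} \<and> affine_dim F = affine_dim S - 1"

lemma affine_dim_eq_aff_dim: "affine_dim S = aff_dim S" for S :: "'a::euclidean_space set"
proof (cases "S = {}")
  case False
  then obtain a where a: "a \<in> S" by blast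
  let ?D = "{x - y | x y. x \<in> S \<and> y \<in> S}" and ?T = "(+) (- a) ` S"
  have "?T \<subseteq> ?D" using a by force
  moreover have "?D \<subseteq> span ?T"
  proof clarify
    fix x y assume "x \<in> S" "y \<in> S"
    then have "(- a + x) - (- a + y) \<in> span ?T"
      by (intro span_diff span_base) auto
    then show "x - y \<in> span ?T" by simp
  qed
  ultimately have "dim ?D = dim ?T"
    by (meson dim_subset dim_mono le_antisym)
  then show ?thesis
    using aff_dim_eq_dim[OF hull_inc[OF a]] False by (simp add: affine_dim_def)
qed (simp add: affine_dim_def)

corollary is_facet_of_iff_facet_of:
  "is_facet_of F S \<longleftrightarrow> F facet_of S" for S :: "'a::euclidean_space set"
  by (simp add: is_facet_of_def facet_of_def affine_dim_eq_aff_dim)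

definition affine_map_on ::
    "'i set \<Rightarrow> 'j set \<Rightarrow> (('i \<Rightarrow>\<^sub>0 real) \<Rightarrow> ('j \<Rightarrow>\<^sub>0 real)) \<Rightarrow> bool" where
  "affine_map_on I J p \<longleftrightarrow> p ` coord_space I \<subseteq> coord_space J \<and>
     (\<exists>f c. linear f \<and> (\<forall>x\<in>coord_space I. p x = f x + c))"

definition is_extension :: "nat \<Rightarrow> (nat \<Rightarrow>\<^sub>0 real) set \<Rightarrow> ((nat \<Rightarrow>\<^sub>0 real) \<Rightarrow> ('j \<Rightarrow>\<^sub>0 real)) \<Rightarrow>
    'j set \<Rightarrow> ('j \<Rightarrow>\<^sub>0 real) set \<Rightarrow> bool" where
  "is_extension d Q p J P \<longleftrightarrow>
     polyhedron_in d Q \<and> affine_map_on {..<d} J p \<and> p ` Q = P"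

text \<open>A polyhedron has finitely many facets, so \<open>card\<close> is meaningful here.\<close>

definition extension_size :: "(nat \<Rightarrow>\<^sub>0 real) set \<Rightarrow> nat" where
  "extension_size Q = card {F. is_facet_of F Q}"

text \<open>The usual binary encoding length: sign bit and binary digits of an integer, and the sum of
  the lengths of numerator and denominator (in lowest terms) of a rational.\<close>

definition int_enc_length :: "int \<Rightarrow> int" where
  "int_enc_length z = 1 + \<lceil>log 2 (real_of_int (\<bar>z\<bar> + 1))\<rceil>"

definition rat_enc_length :: "rat \<Rightarrow> int" where
  "rat_enc_length q = (let (a, b) = quotient_of q in int_enc_length a + int_enc_length b)"

definition enc_bounded :: "real \<Rightarrow> real \<Rightarrow> bool" where
  "enc_bounded C r \<longleftrightarrow> (\<exists>q. r = of_rat q \<and> real_of_int (rat_enc_length q) \<le> C)"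

definition extension_enc_bounded :: "real \<Rightarrow> nat \<Rightarrow> (nat \<Rightarrow>\<^sub>0 real) set \<Rightarrow>
    ((nat \<Rightarrow>\<^sub>0 real) \<Rightarrow> ('j \<Rightarrow>\<^sub>0 real)) \<Rightarrow> 'j set \<Rightarrow> bool" where
  "extension_enc_bounded C d Q p J \<longleftrightarrow>
     (\<exists>Eqs Ineqs. finite Eqs \<and> finite Ineqs \<and> Q = solution_set d Eqs Ineqs \<and>
        (\<forall>(a, b)\<in>Eqs \<union> Ineqs. (\<forall>i<d. enc_bounded C (a i)) \<and> enc_bounded C b)) \<and>
     (\<exists>T t. (\<forall>x\<in>coord_space {..<d}. \<forall>j\<in>J. Poly_Mapping.lookup (p x) j = lin_form d (T j) x + t j) \<and>
        (\<forall>j\<in>J. (\<forall>i<d. enc_bounded C (T j i)) \<and> enc_bounded C (t j)))"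

end

theory Submission
  imports Defs
begin

text \<open>
  Color coding reduces the problem to \<open>2\<^bsup>O(l)\<^esup> log n\<close> colorings \<open>f\<close> of the nodes with \<open>2 l\<close> colors
  such that every set of \<open>2 l\<close> nodes is colored injectively by some \<open>f\<close>. For a fixed \<open>f\<close>, the
  matchings whose nodes receive each color exactly once are the walks from \<open>{}\<close> to the full color
  set in the acyclic network that adds, with each edge \<open>e\<close>, the two colors \<open>f ` e\<close> to the set
  \<open>S\<close> of colors used so far; it has at most \<open>4\<^sup>l n\<^sup>2\<close> arcs. The disjoint union of these networks over
  all \<open>f\<close> is again a layered network, and the unit flows in it project onto the convex hull of the
  walks. The flow polytope has \<open>0/\<plusminus>1\<close> coefficients and at most one facet per arc. Thus neither
  Edmonds' description of the perfect matching polytope nor disjunctive programming is needed.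
\<close>

section \<open>Facets of solution sets\<close>

text \<open>A basis of \<open>D\<close> extends to a basis \<open>B'\<close> of
  \<open>span V\<close>, properly because \<open>v\<close> lies outside \<open>span D\<close>. The
  finite \<open>T\<close> makes \<open>B'\<close> finite, so that the proper inclusion becomes a
  strict inequality of cardinalities.\<close>

lemma dim_less_if_proper_subspan:
  fixes D V T :: "'a::real_vector set"
  assumes "D \<subseteq> span V" "v \<in> V" "v \<notin> span D" "finite T" "V \<subseteq> span T"
  shows "dim D < dim V"
proof -
  obtain B where B: "B \<subseteq> D" "independent B" "D \<subseteq> span B" "card B = dim D"
    by (rule basis_exists)
  obtain B' where B': "B \<subseteq> B'" "B' \<subseteq> span V" "independent B'" "span V \<subseteq> span B'"
    by (rule maximal_independent_subset_extend[OF order_trans[OF B(1) assms(1)] B(2)])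
  have "span V \<subseteq> span T"
    using assms(5) by (simp add: span_minimal)
  then have "finite B'"
    using independent_span_bound[OF assms(4) B'(3)] B'(2) by blast
  moreover have "card B' = dim V"
    using basis_card_eq_dim[OF B'(2,4,3)] by simp
  moreover have "B \<noteq> B'"
    using assms(2,3) span_mono[OF B(1)] B'(4) span_base[OF assms(2)] by auto
  ultimately show ?thesis
    using B(4) B'(1) psubset_card_mono[of B' B] by auto
qed

section \<open>Linear forms and coordinate spaces\<close>

lemma linear_lookup: "linear (\<lambda>x. Poly_Mapping.lookup x i :: real)"
  by (rule linearI) (simp_all add: lookup_add scaleR_poly_mapping_def)

lemma linear_lin_form: "linear (lin_form d a)"
  unfolding lin_form_def
  by (rule linear_compose_sum)
    (auto intro!: linear_compose[OF linear_lookup, unfolded o_def] linear_times)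

lemma subspace_coord_space: "subspace (coord_space I)"
  by (auto simp: subspace_def coord_space_def in_keys_iff subset_iff lookup_add
      scaleR_poly_mapping_def) (metis add_0)

lemma sum_single_lookup:
  fixes d :: nat
  assumes "x \<in> coord_space {..<d}"
  shows "(\<Sum>i<d. Poly_Mapping.lookup x i *\<^sub>R Poly_Mapping.single i 1) = x"
proof (rule poly_mapping_eqI)
  fix j
  have "Poly_Mapping.lookup (\<Sum>i<d. Poly_Mapping.lookup x i *\<^sub>R Poly_Mapping.single i 1) j =
      (\<Sum>i<d. if i = j then Poly_Mapping.lookup x j else 0)"
    unfolding linear_sum[OF linear_lookup] linear_scale[OF linear_lookup]
    by (intro sum.cong) (auto simp: lookup_single)
  also have "\<dots> = Poly_Mapping.lookup x j"
    using assms by (auto simp: coord_space_def in_keys_iff)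
  finally show "Poly_Mapping.lookup
      (\<Sum>i<d. Poly_Mapping.lookup x i *\<^sub>R Poly_Mapping.single i 1) j = Poly_Mapping.lookup x j" .
qed

text \<open>This supplies the finite spanning set that dimension comparisons inside the
  infinite-dimensional ambient space require.\<close>

lemma coord_space_subset_span:
  "coord_space {..<d} \<subseteq> span ((\<lambda>i. Poly_Mapping.single i 1 :: nat \<Rightarrow>\<^sub>0 real) ` {..<d})"
proof
  fix x :: "nat \<Rightarrow>\<^sub>0 real" assume "x \<in> coord_space {..<d}"
  then show "x \<in> span ((\<lambda>i. Poly_Mapping.single i 1) ` {..<d})"
    by (subst sum_single_lookup[symmetric, of x d])
      (assumption, intro span_sum span_scale span_base imageI)
qed

lemma convex_solution_set: "convex (solution_set d Eqs Ineqs)"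
proof (rule convexI)
  fix x y :: "nat \<Rightarrow>\<^sub>0 real" and u v :: real
  assume xy: "x \<in> solution_set d Eqs Ineqs" "y \<in> solution_set d Eqs Ineqs"
    and uv: "0 \<le> u" "0 \<le> v" "u + v = 1"
  have lin: "lin_form d a (u *\<^sub>R x + v *\<^sub>R y) = u * lin_form d a x + v * lin_form d a y" for a
    by (simp add: linear_add[OF linear_lin_form] linear_scale[OF linear_lin_form])
  have "u * s + v * t = b" if "s = b" "t = b" for s t b :: real
    using that uv by (simp add: distrib_right[symmetric])
  moreover have "u * s + v * t \<le> b" if "s \<le> b" "t \<le> b" for s t b :: real
    using convex_bound_le[OF that uv] .
  ultimately show "u *\<^sub>R x + v *\<^sub>R y \<in> solution_set d Eqs Ineqs"
    using xy subspace_coord_space[of "{..<d}"]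
    by (auto simp: solution_set_def lin subspace_add subspace_scale split_beta)
qed

text \<open>Induction on \<open>J\<close>: the midpoint of a point that is slack for the earlier
  inequalities and one that is slack for the new inequality is slack for all of them, since no
  inequality is violated on \<open>F\<close>. The resulting point plays the part of a relative
  interior point of \<open>F\<close>.\<close>

lemma exists_slack_point:
  assumes "convex F" "F \<noteq> {}" "F \<subseteq> solution_set d Eqs Ineqs" "finite J" "J \<subseteq> Ineqs"
  shows "\<exists>z\<in>F. \<forall>(a, b)\<in>J. (\<exists>x\<in>F. lin_form d a x \<noteq> b) \<longrightarrow> lin_form d a z < b"
  using assms(4,5)
proof (induction J rule: finite_induct)
  case empty
  then show ?case using assms(2) by auto
next
  case (insert c J)
  obtain a b where c: "c = (a, b)" by (cases c)
  obtain z where z: "z \<in> F" "\<forall>(a, b)\<in>J. (\<exists>x\<in>F. lin_form d a x \<noteq> b) \<longrightarrow> lin_form d a z < b"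
    using insert by auto
  show ?case
  proof (cases "\<exists>x\<in>F. lin_form d a x \<noteq> b")
    case False
    then show ?thesis using z c by auto
  next
    case True
    then obtain x where x: "x \<in> F" "lin_form d a x \<noteq> b" by auto
    define w where "w = (1/2) *\<^sub>R z + (1/2) *\<^sub>R x"
    have w: "w \<in> F"
      unfolding w_def using assms(1) z(1) x(1) by (simp add: convexD)
    have le: "lin_form d a' y \<le> b'" if "y \<in> F" "(a', b') \<in> Ineqs" for a' b' y
      using that assms(3) by (auto simp: solution_set_def)
    have lin: "lin_form d a' w = (lin_form d a' z + lin_form d a' x) / 2" for a'
      by (simp add: w_def linear_add[OF linear_lin_form] linear_scale[OF linear_lin_form] field_simps)
    have "lin_form d a w < b"
      using le[OF z(1), of a b] le[OF x(1), of a b] x(2) insert.prems c by (auto simp: lin)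
    moreover have "lin_form d a' w < b'" if "(a', b') \<in> J" "\<exists>x\<in>F. lin_form d a' x \<noteq> b'" for a' b'
      using z(2) that le[OF x(1), of a' b'] insert.prems by (fastforce simp: lin)
    ultimately show ?thesis
      using w c by (intro bexI[of _ w]) auto
  qed
qed

text \<open>Take a point \<open>z\<close> of \<open>F\<close> that is slack wherever possible. If
  \<open>x\<close> satisfies with equality everything that is tight on \<open>F\<close>, then the
  segment from \<open>x\<close> to \<open>z\<close> can be prolonged a little beyond
  \<open>z\<close> inside the solution set. So \<open>z\<close> lies in an open segment with
  endpoint \<open>x\<close>, and the face property puts \<open>x\<close> into
  \<open>F\<close>.\<close>

lemma face_of_solution_set:
  assumes fin: "finite Ineqs" and face: "F face_of solution_set d Eqs Ineqs" and "F \<noteq> {}"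
  shows "F = {x \<in> solution_set d Eqs Ineqs.
    \<forall>(a, b)\<in>Ineqs. (\<forall>y\<in>F. lin_form d a y = b) \<longrightarrow> lin_form d a x = b}"
    (is "F = ?G")
proof
  let ?Q = "solution_set d Eqs Ineqs"
  have FQ: "F \<subseteq> ?Q" and cF: "convex F"
    using face by (auto simp: face_of_def)
  show "F \<subseteq> ?G" using FQ by auto
  obtain z where z: "z \<in> F"
    and zs: "\<And>a b. (a, b) \<in> Ineqs \<Longrightarrow> (\<exists>x\<in>F. lin_form d a x \<noteq> b) \<Longrightarrow> lin_form d a z < b"
    using exists_slack_point[OF cF \<open>F \<noteq> {}\<close> FQ fin] by blast
  show "?G \<subseteq> F"
  proof
    fix x assume x: "x \<in> ?G"
    show "x \<in> F"
    proof (cases "x = z")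
      case True then show ?thesis using z by simp
    next
      case False
      have lin: "lin_form d a (z + e *\<^sub>R (z - x)) = lin_form d a z + e * (lin_form d a z - lin_form d a x)"
        for a e
        by (simp add: linear_add[OF linear_lin_form] linear_scale[OF linear_lin_form]
            linear_diff[OF linear_lin_form])
      have "\<forall>\<^sub>F e in at_right 0. lin_form d (fst c) (z + e *\<^sub>R (z - x)) \<le> snd c" if c: "c \<in> Ineqs" for c
      \<comment> \<open>An inequality tight on all of \<open>F\<close> is tight at both
        \<open>z\<close> and \<open>x\<close>, hence on the whole line through them. Any other one
        is strict at \<open>z\<close> and stays strict for small \<open>e\<close> by
        continuity.\<close>
      proof (cases "\<exists>y\<in>F. lin_form d (fst c) y \<noteq> snd c")
        case False
        then have "lin_form d (fst c) z = snd c" "lin_form d (fst c) x = snd c"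
          using x z c by auto
        then show ?thesis by (simp add: lin)
      next
        case True
        then have "lin_form d (fst c) z < snd c"
          using zs c by (metis prod.collapse)
        moreover have "((\<lambda>e. lin_form d (fst c) z + e * (lin_form d (fst c) z - lin_form d (fst c) x))
            \<longlongrightarrow> lin_form d (fst c) z + 0 * (lin_form d (fst c) z - lin_form d (fst c) x)) (at_right 0)"
          by (intro tendsto_intros)
        ultimately have "\<forall>\<^sub>F e in at_right 0.
            lin_form d (fst c) z + e * (lin_form d (fst c) z - lin_form d (fst c) x) < snd c"
          using order_tendstoD(2) by fastforce
        then show ?thesis
          by (rule eventually_mono) (simp add: lin)
      qed
      then have "\<forall>\<^sub>F e in at_right 0. \<forall>c\<in>Ineqs. lin_form d (fst c) (z + e *\<^sub>R (z - x)) \<le> snd c"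
        using fin by (simp add: eventually_ball_finite)
      moreover have "\<forall>\<^sub>F e::real in at_right 0. 0 < e"
        by (simp add: eventually_at_right_less)
      ultimately have "\<forall>\<^sub>F e::real in at_right 0. 0 < e \<and>
          (\<forall>c\<in>Ineqs. lin_form d (fst c) (z + e *\<^sub>R (z - x)) \<le> snd c)"
        by eventually_elim simp
      then obtain e :: real where e: "0 < e"
        "\<forall>c\<in>Ineqs. lin_form d (fst c) (z + e *\<^sub>R (z - x)) \<le> snd c"
        using eventually_happens'[OF trivial_limit_at_right_real] by blast
      define y where "y = z + e *\<^sub>R (z - x)"
      have "y \<in> ?Q"
        using e(2) x z FQ subspace_coord_space[of "{..<d}"]
        by (fastforce simp: solution_set_def y_def lin subspace_add subspace_scale subspace_diff)
      moreover have "z \<in> open_segment x y"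
      proof -
        have "z - x = (1 / (1 + e)) *\<^sub>R (y - x)"
        proof -
          have "y - x = (1 + e) *\<^sub>R (z - x)" by (simp add: y_def algebra_simps)
          then show ?thesis using e(1) by simp
        qed
        then have "z = (1 - 1 / (1 + e)) *\<^sub>R x + (1 / (1 + e)) *\<^sub>R y"
          by (simp add: algebra_simps)
        moreover have "x \<noteq> y"
          using \<open>z - x = _\<close> False by auto
        moreover have "0 < 1 / (1 + e)" "1 / (1 + e) < 1"
          using e(1) by auto
        ultimately show ?thesis
          unfolding in_segment(2) by blast
      qed
      ultimately show ?thesis
        using face z x unfolding face_of_def by blast
    qed
  qed
qed

text \<open>Choose an inequality that is tight on \<open>F\<close> but not at some point of the
  solution set outside \<open>F\<close>. If its tight set were larger than \<open>F\<close>, it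
  would lie strictly between \<open>F\<close> and the solution set, and the dimension would drop
  twice, whereas a facet allows a drop of only one.\<close>

lemma facet_of_solution_set:
  assumes fin: "finite Ineqs" and facet: "is_facet_of F (solution_set d Eqs Ineqs)"
  shows "\<exists>(a, b)\<in>Ineqs. F = {x \<in> solution_set d Eqs Ineqs. lin_form d a x = b}"
proof -
  let ?Q = "solution_set d Eqs Ineqs"
  let ?D = "\<lambda>S::(nat \<Rightarrow>\<^sub>0 real) set. {x - y | x y. x \<in> S \<and> y \<in> S}"
  let ?T = "(\<lambda>i. Poly_Mapping.single i 1 :: nat \<Rightarrow>\<^sub>0 real) ` {..<d}"
  have face: "F face_of ?Q" and ne: "F \<noteq> {}" and dim: "affine_dim F = affine_dim ?Q - 1"
    using facet by (auto simp: is_facet_of_def)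
  note F_eq = face_of_solution_set[OF fin face ne]
  have FQ: "F \<subseteq> ?Q" using face by (auto simp: face_of_def)
  obtain z where z: "z \<in> F" using ne by auto
  \<comment> \<open>The form given by \<open>a\<close> vanishes on all differences of points of
    \<open>S\<close> but not on \<open>x - z\<close>, so \<open>x - z\<close> is a direction of
    \<open>S'\<close> outside the span of the directions of \<open>S\<close>.\<close>
  have less: "dim (?D S) < dim (?D S')"
    if "S \<subseteq> S'" "S' \<subseteq> ?Q" "z \<in> S" "x \<in> S'" "lin_form d a x \<noteq> b" "\<forall>y\<in>S. lin_form d a y = b" for S S' a b x
  proof (rule dim_less_if_proper_subspan)
    show "?D S \<subseteq> span (?D S')" using that(1) by (auto intro!: span_base)
    show "x - z \<in> ?D S'" using that by auto
    have "subspace {v. lin_form d a v = 0}"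
      by (simp add: subspace_def linear_0[OF linear_lin_form] linear_add[OF linear_lin_form]
          linear_scale[OF linear_lin_form])
    moreover have "?D S \<subseteq> {v. lin_form d a v = 0}"
      using that(6) by (auto simp: linear_diff[OF linear_lin_form])
    ultimately have "span (?D S) \<subseteq> {v. lin_form d a v = 0}"
      by (rule span_minimal[rotated])
    then show "x - z \<notin> span (?D S)"
      using that by (auto simp: linear_diff[OF linear_lin_form])
    show "finite ?T" by simp
    show "?D S' \<subseteq> span ?T"
    proof clarify
      fix x y assume "x \<in> S'" "y \<in> S'"
      then have "x - y \<in> coord_space {..<d}"
        using that(2) subspace_coord_space[of "{..<d}"]
        by (auto simp: solution_set_def intro!: subspace_diff)
      then show "x - y \<in> span ?T" using coord_space_subset_span by blast
    qed
  qed
  have dimF: "int (dim (?D F)) = int (dim (?D ?Q)) - 1"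
    using dim ne FQ unfolding affine_dim_def by (auto split: if_splits)
  have "F \<noteq> ?Q" using dimF by auto
  then obtain x where x: "x \<in> ?Q" "x \<notin> F" using FQ by auto
  then obtain a b where ab: "(a, b) \<in> Ineqs" "\<forall>y\<in>F. lin_form d a y = b" "lin_form d a x \<noteq> b"
    using F_eq by blast
  let ?G = "{x \<in> ?Q. lin_form d a x = b}"
  have FG: "F \<subseteq> ?G" using FQ ab by auto
  have "F = ?G"
  proof (rule ccontr)
    assume "F \<noteq> ?G"
    then obtain w where w: "w \<in> ?G" "w \<notin> F" using FG by auto
    then obtain a' b' where ab': "\<forall>y\<in>F. lin_form d a' y = b'" "lin_form d a' w \<noteq> b'"
      using F_eq by blast
    have "dim (?D F) < dim (?D ?G)"
      by (rule less[OF FG _ z w(1) ab'(2,1)]) auto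
    moreover have "dim (?D ?G) < dim (?D ?Q)"
      by (rule less[OF _ _ _ x(1) ab(3)]) (use z FG in auto)
    ultimately show False using dimF by linarith
  qed
  then show ?thesis using ab(1) by blast
qed

text \<open>Each facet is the tight set of a single inequality, so the facets lie in the image of a
  map on \<open>Ineqs\<close>; equations cost nothing.\<close>

lemma extension_size_solution_set_le:
  assumes "finite Ineqs"
  shows "extension_size (solution_set d Eqs Ineqs) \<le> card Ineqs"
proof -
  have "{F. is_facet_of F (solution_set d Eqs Ineqs)} \<subseteq>
      (\<lambda>(a, b). {x \<in> solution_set d Eqs Ineqs. lin_form d a x = b}) ` Ineqs"
    using facet_of_solution_set[OF assms] by fast
  then show ?thesis
    unfolding extension_size_def by (meson assms card_image_le card_mono finite_imageI order_trans)
qed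

section \<open>Evaluation of coordinate sums and 0/1 forms\<close>

lemma sum_lookup_add_single:
  "finite A \<Longrightarrow> (\<Sum>j\<in>A. Poly_Mapping.lookup (x + Poly_Mapping.single i (1::real)) j) =
    (\<Sum>j\<in>A. Poly_Mapping.lookup x j) + of_bool (i \<in> A)"
  by (simp add: lookup_add sum.distrib lookup_single when_def)

lemma lin_form_of_bool:
  "lin_form d (\<lambda>i. of_bool (P i)) x = (\<Sum>i\<in>{i\<in>{..<d}. P i}. Poly_Mapping.lookup x i)"
  unfolding lin_form_def by (auto intro!: sum.mono_neutral_cong_right)

lemma lin_form_diff: "lin_form d (\<lambda>i. a i - b i) x = lin_form d a x - lin_form d b x"
  by (simp add: lin_form_def algebra_simps sum_subtractf)

section \<open>Unit flows in layered networks\<close>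

text \<open>Arcs are the numbers below \<open>d\<close>, so that they index the coordinates of a flow directly.\<close>

locale layered_network =
  fixes d L :: nat
    and src tgt :: "nat \<Rightarrow> 'v"
    and lab :: "nat \<Rightarrow> ('j \<Rightarrow>\<^sub>0 real)"
    and level :: "'v \<Rightarrow> nat"
  assumes level_tgt: "i < d \<Longrightarrow> level (tgt i) = Suc (level (src i))"
    and level_src: "i < d \<Longrightarrow> level (src i) < L"
    and L_pos: "0 < L"
begin

definition nodes :: "'v set" where
  "nodes = src ` {..<d} \<union> tgt ` {..<d}"

definition layer :: "nat \<Rightarrow> 'v set" where
  "layer k = {v \<in> nodes. level v = k}"

definition arcs_from :: "nat \<Rightarrow> nat set" where
  "arcs_from k = {i \<in> {..<d}. level (src i) = k}"

definition inflow :: "(nat \<Rightarrow>\<^sub>0 real) \<Rightarrow> 'v \<Rightarrow> real" where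
  "inflow x v = (\<Sum>i\<in>{i \<in> {..<d}. tgt i = v}. Poly_Mapping.lookup x i)"

definition outflow :: "(nat \<Rightarrow>\<^sub>0 real) \<Rightarrow> 'v \<Rightarrow> real" where
  "outflow x v = (\<Sum>i\<in>{i \<in> {..<d}. src i = v}. Poly_Mapping.lookup x i)"

text \<open>One equation fixes the total flow out of level 0, rather than one equation per source.
  The unit may thus be split among all start nodes, which is how a single flow polytope covers the
  union over all colorings. Flow may end at any node of level \<open>L\<close>, since conservation
  is imposed only strictly between the two extreme levels.\<close>

definition flow_eqs :: "((nat \<Rightarrow> real) \<times> real) set" where
  "flow_eqs = insert (\<lambda>i. of_bool (level (src i) = 0), 1)
     ((\<lambda>v. (\<lambda>i. of_bool (tgt i = v) - of_bool (src i = v), 0)) `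
       {v \<in> nodes. 0 < level v \<and> level v < L})"

definition flow_ineqs :: "((nat \<Rightarrow> real) \<times> real) set" where
  "flow_ineqs = (\<lambda>i. (\<lambda>k. - of_bool (k = i), 0)) ` {..<d}"

definition flows :: "(nat \<Rightarrow>\<^sub>0 real) set" where
  "flows = solution_set d flow_eqs flow_ineqs"

definition project :: "(nat \<Rightarrow>\<^sub>0 real) \<Rightarrow> ('j \<Rightarrow>\<^sub>0 real)" where
  "project x = (\<Sum>i<d. Poly_Mapping.lookup x i *\<^sub>R lab i)"

text \<open>Only the end node and the label sum are recorded, because only the projected point
  matters. A walk begins at a node with an outgoing arc, so it stays within
  \<open>nodes\<close>.\<close>

inductive walk :: "'v \<Rightarrow> ('j \<Rightarrow>\<^sub>0 real) \<Rightarrow> bool" where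
  start: "i < d \<Longrightarrow> level (src i) = 0 \<Longrightarrow> walk (src i) 0"
| step: "walk (src i) w \<Longrightarrow> i < d \<Longrightarrow> walk (tgt i) (w + lab i)"

section \<open>Membership in the flow polytope and sums over layers\<close>

lemma finite_layer [simp]: "finite (layer k)"
  by (simp add: layer_def nodes_def)

lemma finite_arcs_from [simp]: "finite (arcs_from k)"
  by (simp add: arcs_from_def)

lemma mem_flows_iff:
  "x \<in> flows \<longleftrightarrow> x \<in> coord_space {..<d} \<and> (\<forall>i<d. 0 \<le> Poly_Mapping.lookup x i) \<and>
     (\<Sum>i\<in>arcs_from 0. Poly_Mapping.lookup x i) = 1 \<and>
     (\<forall>v\<in>nodes. 0 < level v \<and> level v < L \<longrightarrow> inflow x v = outflow x v)"
proof -
  have "lin_form d (\<lambda>k. - of_bool (k = i)) x = - Poly_Mapping.lookup x i" if "i < d" for i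
    using that by (simp add: lin_form_def sum_negf)
  then have "(\<forall>(a, b)\<in>flow_ineqs. lin_form d a x \<le> b) \<longleftrightarrow> (\<forall>i<d. 0 \<le> Poly_Mapping.lookup x i)"
    by (auto simp: flow_ineqs_def)
  moreover have "(\<forall>(a, b)\<in>flow_eqs. lin_form d a x = b) \<longleftrightarrow>
     (\<Sum>i\<in>arcs_from 0. Poly_Mapping.lookup x i) = 1 \<and>
     (\<forall>v\<in>nodes. 0 < level v \<and> level v < L \<longrightarrow> inflow x v = outflow x v)"
    by (auto simp: flow_eqs_def lin_form_diff lin_form_of_bool arcs_from_def inflow_def outflow_def)
  ultimately show ?thesis
    by (auto simp: flows_def solution_set_def)
qed

lemma linear_project: "linear project"
  unfolding project_def
  by (intro linear_compose_sum ballI linearI)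
    (simp_all add: linear_add[OF linear_lookup] linear_scale[OF linear_lookup] scaleR_add_left)

lemma project_single: "i < d \<Longrightarrow> project (Poly_Mapping.single i 1) = lab i"
proof -
  assume "i < d"
  have "project (Poly_Mapping.single i 1) = (\<Sum>j<d. if j = i then lab i else 0)"
    unfolding project_def by (intro sum.cong) (auto simp: lookup_single)
  then show ?thesis using \<open>i < d\<close> by simp
qed

lemma outflow_eq_sum_layer:
  "level v = k \<Longrightarrow> outflow x v = (\<Sum>i\<in>{i \<in> arcs_from k. src i = v}. Poly_Mapping.lookup x i)"
  unfolding outflow_def arcs_from_def by (rule sum.cong) auto

lemma inflow_eq_sum_layer:
  "level v = Suc k \<Longrightarrow> inflow x v = (\<Sum>i\<in>{i \<in> arcs_from k. tgt i = v}. Poly_Mapping.lookup x i)"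
  unfolding inflow_def arcs_from_def by (rule sum.cong) (auto simp: level_tgt)

lemma src_layer: "src ` arcs_from k \<subseteq> layer k"
  by (auto simp: arcs_from_def layer_def nodes_def)

lemma tgt_layer: "tgt ` arcs_from k \<subseteq> layer (Suc k)"
  by (auto simp: arcs_from_def layer_def nodes_def level_tgt)

text \<open>
  With \<open>fl v\<close> the flow through \<open>v\<close>, the point \<open>h v\<close> is the average label sum of a random walk to \<open>v\<close>
  that leaves each node along an arc with probability proportional to the flow on it. When
  \<open>fl v = 0\<close>, there may be no walk to \<open>v\<close>.
\<close>

lemma flow_decomposition:
  assumes x: "x \<in> flows" and "k \<le> L"
  defines "fl \<equiv> (\<lambda>v. if level v = 0 then outflow x v else inflow x v)"
  shows "\<exists>h. (\<forall>v\<in>layer k. 0 < fl v \<longrightarrow> h v \<in> convex hull {w. walk v w}) \<and>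
     (\<Sum>v\<in>layer k. fl v) = 1 \<and>
     (\<Sum>v\<in>layer k. fl v *\<^sub>R h v) =
       (\<Sum>i\<in>{i \<in> {..<d}. level (src i) < k}. Poly_Mapping.lookup x i *\<^sub>R lab i)"
  using assms(2)
proof (induction k)
  case 0
  \<comment> \<open>Targets of arcs have positive level, so a node on level 0 is the source of some
    arc.\<close>
  have "walk v 0" if "v \<in> layer 0" for v
    using that walk.start by (auto simp: layer_def nodes_def level_tgt)
  then have "\<forall>v\<in>layer 0. 0 < fl v \<longrightarrow> 0 \<in> convex hull {w. walk v w}"
    by (auto intro: hull_inc)
  moreover have "(\<Sum>v\<in>layer 0. fl v) =
      (\<Sum>v\<in>layer 0. \<Sum>i\<in>{i \<in> arcs_from 0. src i = v}. Poly_Mapping.lookup x i)"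
    by (rule sum.cong) (auto simp: fl_def layer_def outflow_eq_sum_layer)
  moreover have "\<dots> = 1"
    using x src_layer by (simp add: sum.group mem_flows_iff)
  ultimately show ?case
    by (intro exI[of _ "\<lambda>_. 0"]) simp
next
  case (Suc k)
  let ?x = "Poly_Mapping.lookup x"
  obtain h where h: "\<And>v. v \<in> layer k \<Longrightarrow> 0 < fl v \<Longrightarrow> h v \<in> convex hull {w. walk v w}"
    and fl1: "(\<Sum>v\<in>layer k. fl v) = 1"
    and hsum: "(\<Sum>v\<in>layer k. fl v *\<^sub>R h v) =
       (\<Sum>i\<in>{i \<in> {..<d}. level (src i) < k}. ?x i *\<^sub>R lab i)"
    using Suc by auto
  have nonneg: "0 \<le> ?x i" if "i \<in> arcs_from k" for i
    using x that by (simp add: mem_flows_iff arcs_from_def)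
  \<comment> \<open>On level 0 this is the definition of \<open>fl\<close>. On a level
    \<open>k > 0\<close> it is flow conservation, available because \<open>Suc k \<le> L\<close>
    gives \<open>k < L\<close>.\<close>
  have fl_out: "fl u = (\<Sum>i\<in>{i \<in> arcs_from k. src i = u}. ?x i)" if "u \<in> layer k" for u
    using that x Suc.prems unfolding mem_flows_iff
    by (auto simp: fl_def layer_def outflow_eq_sum_layer)
  have fl_in: "fl v = (\<Sum>i\<in>{i \<in> arcs_from k. tgt i = v}. ?x i)" if "v \<in> layer (Suc k)" for v
    using that by (auto simp: fl_def layer_def inflow_eq_sum_layer)
  \<comment> \<open>Only arcs carrying positive flow enter the average: an arc without flow may
    start at a node whose \<open>h\<close> value is uncontrolled.\<close>
  define S where "S v = {i \<in> arcs_from k. tgt i = v \<and> 0 < ?x i}" for v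
  have S_sub: "S v \<subseteq> {i \<in> arcs_from k. tgt i = v}" for v
    by (auto simp: S_def)
  have S_zero: "?x i = 0" if "i \<in> {i \<in> arcs_from k. tgt i = v} - S v" for i v
    using that nonneg[of i] by (auto simp: S_def)
  have fin: "finite {i \<in> arcs_from k. P i}" for P by simp
  have fl_S: "fl v = (\<Sum>i\<in>S v. ?x i)" if "v \<in> layer (Suc k)" for v
    unfolding fl_in[OF that] by (rule sum.mono_neutral_right) (use S_sub S_zero in auto)
  define h' where "h' v = (\<Sum>i\<in>S v. (?x i / fl v) *\<^sub>R (h (src i) + lab i))" for v
  \<comment> \<open>If \<open>fl v = 0\<close>, division by zero makes \<open>h' v\<close> zero, and
    the right-hand side vanishes too because no arc into \<open>v\<close> carries flow.\<close>
  have scale: "fl v *\<^sub>R h' v = (\<Sum>i\<in>{i \<in> arcs_from k. tgt i = v}. ?x i *\<^sub>R (h (src i) + lab i))"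
    if v: "v \<in> layer (Suc k)" for v
  proof -
    have "?x i = 0" if "fl v = 0" "i \<in> S v" for i
      using that sum_nonneg_eq_0_iff[of "S v" ?x] fl_S[OF v] nonneg by (auto simp: S_def)
    then have "fl v *\<^sub>R h' v = (\<Sum>i\<in>S v. ?x i *\<^sub>R (h (src i) + lab i))"
      unfolding h'_def scaleR_sum_right by (cases "fl v = 0") auto
    also have "\<dots> = (\<Sum>i\<in>{i \<in> arcs_from k. tgt i = v}. ?x i *\<^sub>R (h (src i) + lab i))"
      by (rule sum.mono_neutral_left) (use S_sub S_zero in auto)
    finally show ?thesis .
  qed
  have "h' v \<in> convex hull {w. walk v w}" if v: "v \<in> layer (Suc k)" "0 < fl v" for v
    unfolding h'_def
  proof (rule convex_sum)
    show "finite (S v)" by (simp add: S_def)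
    show "(\<Sum>i\<in>S v. ?x i / fl v) = 1"
      using fl_S[OF v(1)] v(2) by (simp add: sum_divide_distrib[symmetric])
    show "0 \<le> ?x i / fl v" if "i \<in> S v" for i
      using that v(2) by (auto simp: S_def)
    show "h (src i) + lab i \<in> convex hull {w. walk v w}" if i: "i \<in> S v" for i
    proof -
      have src: "src i \<in> layer k" using i src_layer by (auto simp: S_def)
      \<comment> \<open>An arc with positive flow leaves a node with positive flow, so the induction
        hypothesis applies to its source.\<close>
      have "?x i \<le> fl (src i)"
        unfolding fl_out[OF src] by (rule member_le_sum) (use i nonneg in \<open>auto simp: S_def\<close>)
      then have "h (src i) \<in> convex hull {w. walk (src i) w}"
        using h src i by (auto simp: S_def)
      then have "lab i + h (src i) \<in> convex hull ((+) (lab i) ` {w. walk (src i) w})"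
        by (simp add: convex_hull_translation)
      also have "\<dots> \<subseteq> convex hull {w. walk v w}"
        using i walk.step by (intro hull_mono) (auto simp: S_def arcs_from_def add.commute)
      finally show ?thesis by (simp add: add.commute)
    qed
  qed simp
  moreover have "(\<Sum>v\<in>layer (Suc k). fl v) = 1"
  proof -
    have "(\<Sum>v\<in>layer (Suc k). fl v) = (\<Sum>i\<in>arcs_from k. ?x i)"
      using sum.group[OF _ _ tgt_layer, of k ?x] by (simp add: fl_in)
    also have "\<dots> = (\<Sum>v\<in>layer k. fl v)"
      using sum.group[OF _ _ src_layer, of k ?x] by (simp add: fl_out)
    finally show ?thesis using fl1 by simp
  qed
  \<comment> \<open>Grouping the arcs by target undoes the averaging in \<open>h'\<close>;
    regrouping the \<open>h\<close> terms by source recovers the sum over the previous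
    layer.\<close>
  moreover have "(\<Sum>v\<in>layer (Suc k). fl v *\<^sub>R h' v) =
      (\<Sum>i\<in>{i \<in> {..<d}. level (src i) < Suc k}. ?x i *\<^sub>R lab i)"
  proof -
    have "(\<Sum>v\<in>layer (Suc k). fl v *\<^sub>R h' v) = (\<Sum>i\<in>arcs_from k. ?x i *\<^sub>R (h (src i) + lab i))"
      using sum.group[OF _ _ tgt_layer, of k "\<lambda>i. ?x i *\<^sub>R (h (src i) + lab i)"] by (simp add: scale)
    also have "\<dots> = (\<Sum>i\<in>arcs_from k. ?x i *\<^sub>R h (src i)) + (\<Sum>i\<in>arcs_from k. ?x i *\<^sub>R lab i)"
      by (simp add: scaleR_add_right sum.distrib)
    also have "(\<Sum>i\<in>arcs_from k. ?x i *\<^sub>R h (src i)) =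
        (\<Sum>u\<in>layer k. \<Sum>i\<in>{i \<in> arcs_from k. src i = u}. ?x i *\<^sub>R h (src i))"
      using sum.group[OF _ _ src_layer, of k "\<lambda>i. ?x i *\<^sub>R h (src i)"] by simp
    also have "\<dots> = (\<Sum>u\<in>layer k. fl u *\<^sub>R h u)"
      by (intro sum.cong) (auto simp: fl_out scaleR_sum_left intro!: sum.cong)
    also have "\<dots> + (\<Sum>i\<in>arcs_from k. ?x i *\<^sub>R lab i) =
        (\<Sum>i\<in>{i \<in> {..<d}. level (src i) < k} \<union> arcs_from k. ?x i *\<^sub>R lab i)"
      unfolding hsum by (rule sum.union_disjoint[symmetric]) (auto simp: arcs_from_def)
    also have "{i \<in> {..<d}. level (src i) < k} \<union> arcs_from k = {i \<in> {..<d}. level (src i) < Suc k}"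
      by (auto simp: arcs_from_def)
    finally show ?thesis .
  qed
  ultimately show ?case by blast
qed

text \<open>One unit is placed on each arc as the walk is built, and every new arc moves the excess
  from its source to its target. The total leaving level 0 depends on \<open>level v\<close> because
  the empty walk sends nothing. Excess is tracked on positive levels only, since the start node has
  a deficit.\<close>

lemma walk_imp_flow:
  assumes "walk v w"
  shows "\<exists>x \<in> coord_space {..<d}. (\<forall>i<d. 0 \<le> Poly_Mapping.lookup x i) \<and>
     (\<Sum>i\<in>arcs_from 0. Poly_Mapping.lookup x i) = of_bool (0 < level v) \<and>
     (\<forall>u. 0 < level u \<longrightarrow> inflow x u - outflow x u = of_bool (u = v)) \<and> project x = w"
  using assms
proof (induction rule: walk.induct)
  case (start i)
  then show ?case
    by (intro bexI[of _ 0]) (auto simp: inflow_def outflow_def project_def coord_space_def)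
next
  case (step i w)
  then obtain x where x: "x \<in> coord_space {..<d}" "\<And>i. i < d \<Longrightarrow> 0 \<le> Poly_Mapping.lookup x i"
    "(\<Sum>i\<in>arcs_from 0. Poly_Mapping.lookup x i) = of_bool (0 < level (src i))"
    "\<And>u. 0 < level u \<Longrightarrow> inflow x u - outflow x u = of_bool (u = src i)" "project x = w"
    by auto
  let ?y = "x + Poly_Mapping.single i 1"
  have "Poly_Mapping.single i 1 \<in> coord_space {..<d}"
    using step by (auto simp: coord_space_def)
  then have "?y \<in> coord_space {..<d}"
    using x(1) by (simp add: subspace_add[OF subspace_coord_space])
  moreover have "\<forall>i<d. 0 \<le> Poly_Mapping.lookup ?y i"
    using x(2) by (simp add: lookup_add lookup_single when_def)
  \<comment> \<open>If \<open>src i\<close> is on level 0, the new arc contributes the unit;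
    otherwise the unit is already counted and the new arc adds nothing.\<close>
  moreover have "(\<Sum>i\<in>arcs_from 0. Poly_Mapping.lookup ?y i) = of_bool (0 < level (tgt i))"
    using step(2) x(3) by (simp add: sum_lookup_add_single level_tgt) (simp add: arcs_from_def)
  moreover have "inflow ?y u - outflow ?y u = of_bool (u = tgt i)" if "0 < level u" for u
    using x(4)[OF that] step(2) by (auto simp: inflow_def outflow_def sum_lookup_add_single)
  moreover have "project ?y = w + lab i"
    using x(5) step(2) by (simp add: linear_add[OF linear_project] project_single)
  ultimately show ?case by blast
qed

text \<open>Each walk to level \<open>L\<close> comes from a flow, and the image of the flows is
  convex. Conversely, \<open>flow_decomposition\<close> is applied with \<open>k = L\<close>: every
  arc starts below level \<open>L\<close>, so its label sum is all of \<open>project x\<close>,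
  written as a convex combination of points in the hulls of walks.\<close>

theorem project_flows: "project ` flows = convex hull {w. \<exists>v. level v = L \<and> walk v w}"
proof
  let ?W = "{w. \<exists>v. level v = L \<and> walk v w}"
  show "convex hull ?W \<subseteq> project ` flows"
  proof (rule hull_minimal)
    show "convex (project ` flows)"
      unfolding flows_def by (intro convex_linear_image linear_project convex_solution_set)
    show "?W \<subseteq> project ` flows"
    proof
      fix w assume "w \<in> ?W"
      then obtain v where v: "level v = L" "walk v w" by auto
      obtain x where x: "x \<in> coord_space {..<d}" "\<forall>i<d. 0 \<le> Poly_Mapping.lookup x i"
        "(\<Sum>i\<in>arcs_from 0. Poly_Mapping.lookup x i) = of_bool (0 < level v)"
        "\<forall>u. 0 < level u \<longrightarrow> inflow x u - outflow x u = of_bool (u = v)" "project x = w"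
        using walk_imp_flow[OF v(2)] by blast
      \<comment> \<open>The excess unit sits at \<open>v\<close>, on level \<open>L\<close>, where
        conservation is not imposed.\<close>
      have "inflow x u = outflow x u" if "0 < level u" "level u < L" for u
      proof -
        have "u \<noteq> v" using that v by auto
        then show ?thesis using x(4)[rule_format, OF that(1)] by simp
      qed
      then have "x \<in> flows"
        using x v L_pos by (simp add: mem_flows_iff)
      then show "w \<in> project ` flows" using x(5) by auto
    qed
  qed
  show "project ` flows \<subseteq> convex hull ?W"
  proof clarify
    fix x assume x: "x \<in> flows"
    define fl where "fl = (\<lambda>v. if level v = 0 then outflow x v else inflow x v)"
    obtain h where h: "\<And>v. v \<in> layer L \<Longrightarrow> 0 < fl v \<Longrightarrow> h v \<in> convex hull {w. walk v w}"
      and fl1: "(\<Sum>v\<in>layer L. fl v) = 1"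
      and hsum: "(\<Sum>v\<in>layer L. fl v *\<^sub>R h v) =
        (\<Sum>i\<in>{i \<in> {..<d}. level (src i) < L}. Poly_Mapping.lookup x i *\<^sub>R lab i)"
      using flow_decomposition[OF x order_refl] unfolding fl_def by blast
    have nonneg: "0 \<le> fl v" for v
      using x by (auto simp: fl_def inflow_def outflow_def mem_flows_iff intro!: sum_nonneg)
    \<comment> \<open>End nodes without flow have weight zero but possibly no walk, so they are
      removed before \<open>convex_sum\<close> is applied.\<close>
    define S where "S = {v \<in> layer L. 0 < fl v}"
    have S: "S \<subseteq> layer L" "\<And>v. v \<in> layer L - S \<Longrightarrow> fl v = 0"
      using nonneg by (auto simp: S_def intro: antisym)
    have "{i \<in> {..<d}. level (src i) < L} = {..<d}" using level_src by auto
    then have "project x = (\<Sum>v\<in>layer L. fl v *\<^sub>R h v)"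
      by (simp add: hsum project_def)
    also have "\<dots> = (\<Sum>v\<in>S. fl v *\<^sub>R h v)"
      by (rule sum.mono_neutral_right) (use S in auto)
    also have "\<dots> \<in> convex hull ?W"
    proof (rule convex_sum)
      show "finite S" using S(1) by (rule finite_subset) simp
      show "sum fl S = 1"
        using fl1 sum.mono_neutral_right[of "layer L" S fl] S by simp
      show "h v \<in> convex hull ?W" if "v \<in> S" for v
      proof -
        have "h v \<in> convex hull {w. walk v w}" "level v = L"
          using that h by (auto simp: S_def layer_def)
        moreover have "{w. walk v w} \<subseteq> ?W" using \<open>level v = L\<close> by auto
        ultimately show ?thesis using hull_mono by blast
      qed
    qed (use nonneg in auto)
    finally show "project x \<in> convex hull ?W" .
  qed
qed

section \<open>The flow polytope as an extension: size and encoding length\<close>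

lemma finite_flow_system: "finite flow_eqs" "finite flow_ineqs"
  by (simp_all add: flow_eqs_def flow_ineqs_def nodes_def)

lemma is_extension_flows:
  assumes "\<And>i. i < d \<Longrightarrow> lab i \<in> coord_space J"
  shows "is_extension d flows project J (convex hull {w. \<exists>v. level v = L \<and> walk v w})"
proof -
  have "project x \<in> coord_space J" for x
    unfolding project_def using assms subspace_coord_space
    by (auto intro!: subspace_sum subspace_scale)
  then have "affine_map_on {..<d} J project"
    unfolding affine_map_on_def using linear_project
    by (intro conjI exI[of _ project] exI[of _ 0]) auto
  then show ?thesis
    unfolding is_extension_def polyhedron_in_def
    using finite_flow_system project_flows flows_def by blast
qed

lemma extension_size_flows: "extension_size flows \<le> d"
proof -
  have "card flow_ineqs \<le> d"
    unfolding flow_ineqs_def using card_image_le[of "{..<d}"] by simp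
  then show ?thesis
    unfolding flows_def using extension_size_solution_set_le finite_flow_system(2) order_trans by blast
qed

lemma enc_bounded_flows:
  assumes "\<And>i j. i < d \<Longrightarrow> j \<in> J \<Longrightarrow> Poly_Mapping.lookup (lab i) j \<in> {0, 1}" and "4 \<le> C"
  shows "extension_enc_bounded C d flows project J"
proof -
  \<comment> \<open>The denominator 1 has length 2, and so do the numerators 1 and -1, while the
    numerator 0 has length 1. Hence the bound 4.\<close>
  have "rat_enc_length 0 = 3" "rat_enc_length 1 = 4" "rat_enc_length (- 1) = 4"
    by (simp_all add: rat_enc_length_def int_enc_length_def rat_uminus_code)
  then have enc: "enc_bounded C 0" "enc_bounded C 1" "enc_bounded C (- 1)"
    unfolding enc_bounded_def using assms(2)
    by (intro exI[of _ 0] exI[of _ 1] exI[of _ "- 1"]; simp add: of_rat_minus)+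
  have "enc_bounded C (of_bool P)" "enc_bounded C (- of_bool P)"
    "enc_bounded C (of_bool P - of_bool Q)" for P Q
    using enc by (cases P; cases Q; simp)+
  then have "\<forall>(a, b)\<in>flow_eqs \<union> flow_ineqs. (\<forall>i<d. enc_bounded C (a i)) \<and> enc_bounded C b"
    using enc by (auto simp: flow_eqs_def flow_ineqs_def)
  moreover have "Poly_Mapping.lookup (project x) j = lin_form d (\<lambda>i. Poly_Mapping.lookup (lab i) j) x + 0" for x j
    by (simp add: project_def lin_form_def linear_sum[OF linear_lookup] linear_scale[OF linear_lookup]
        mult.commute)
  moreover have "enc_bounded C (Poly_Mapping.lookup (lab i) j)" if "i < d" "j \<in> J" for i j
    using assms(1)[OF that] enc by auto
  ultimately show ?thesis
    unfolding extension_enc_bounded_def using finite_flow_system flows_def enc(1)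
    by (intro conjI exI[of _ flow_eqs] exI[of _ flow_ineqs]
        exI[of _ "\<lambda>j i. Poly_Mapping.lookup (lab i) j"] exI[of _ "\<lambda>_. 0"]) auto
qed

end

section \<open>Perfect hash families\<close>

text \<open>Double counting of the good pairs: if every \<open>f\<close> were good for less than the
  fraction \<open>r\<close> of \<open>Y\<close>, the total would be below the one obtained by
  summing over \<open>y\<close>.\<close>

lemma exists_good_covering_many:
  fixes r :: real
  assumes "finite F" "finite Y" "F \<noteq> {}"
    and dense: "\<And>y. y \<in> Y \<Longrightarrow> r * card F \<le> card {f \<in> F. good f y}"
  shows "\<exists>f\<in>F. r * card Y \<le> card {y \<in> Y. good f y}"
proof (rule ccontr)
  assume "\<not> ?thesis"
  then have "(\<Sum>f\<in>F. real (card {y \<in> Y. good f y})) < (\<Sum>f\<in>F. r * card Y)"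
    using assms by (intro sum_strict_mono) (auto simp: not_le)
  also have "\<dots> = (\<Sum>y\<in>Y. r * card F)" by simp
  also have "\<dots> \<le> (\<Sum>y\<in>Y. real (card {f \<in> F. good f y}))"
    by (intro sum_mono dense)
  also have "\<dots> = (\<Sum>f\<in>F. real (card {y \<in> Y. good f y}))"
    using sum_multicount_gen[OF assms(2,1), of "\<lambda>y f. good f y" "\<lambda>f. card {y \<in> Y. good f y}"]
    by (simp flip: of_nat_sum)
  finally show False by simp
qed

text \<open>Each round adds an \<open>f\<close> that is good for at least the fraction
  \<open>r\<close> of what is still uncovered, so the remainder shrinks by the factor
  \<open>1 - r\<close>. The bound on \<open>r\<close> keeps this factor nonnegative.\<close>

lemma greedy_covering:
  fixes r :: real
  assumes "finite F" "finite Y" "F \<noteq> {}" "r \<le> 1"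
    and dense: "\<And>y. y \<in> Y \<Longrightarrow> r * card F \<le> card {f \<in> F. good f y}"
  shows "\<exists>\<Phi>\<subseteq>F. card \<Phi> \<le> q \<and> card {y \<in> Y. \<forall>f\<in>\<Phi>. \<not> good f y} \<le> (1 - r) ^ q * card Y"
proof (induction q)
  case 0
  then show ?case by (intro exI[of _ "{}"]) simp
next
  case (Suc q)
  then obtain \<Phi> where \<Phi>: "\<Phi> \<subseteq> F" "card \<Phi> \<le> q"
    "card {y \<in> Y. \<forall>f\<in>\<Phi>. \<not> good f y} \<le> (1 - r) ^ q * card Y" by blast
  define Z where "Z = {y \<in> Y. \<forall>f\<in>\<Phi>. \<not> good f y}"
  have finZ: "finite Z" using assms(2) by (simp add: Z_def)
  obtain f where f: "f \<in> F" "r * card Z \<le> card {y \<in> Z. good f y}"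
    using exists_good_covering_many[OF assms(1) finZ assms(3), of r good] dense by (auto simp: Z_def)
  have "card {y \<in> Z. \<not> good f y} + card {y \<in> Z. good f y} = card Z"
    using card_Int_Diff[OF finZ, of "{y. good f y}"] by (simp add: Int_def set_diff_eq)
  then have "real (card {y \<in> Z. \<not> good f y}) \<le> (1 - r) * card Z"
    using f(2) by (simp add: algebra_simps)
  also have "\<dots> \<le> (1 - r) * ((1 - r) ^ q * card Y)"
    using \<Phi>(3) assms(4) by (intro mult_left_mono) (auto simp: Z_def)
  finally have "real (card {y \<in> Z. \<not> good f y}) \<le> (1 - r) ^ Suc q * card Y" by simp
  moreover have "{y \<in> Z. \<not> good f y} = {y \<in> Y. \<forall>g\<in>insert f \<Phi>. \<not> good g y}"
    by (auto simp: Z_def)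
  moreover have "card (insert f \<Phi>) \<le> Suc q"
    using \<Phi>(2) card_insert_le_m1[of "Suc q" \<Phi> f] by simp
  ultimately show ?case using \<Phi>(1) f(1) by (intro exI[of _ "insert f \<Phi>"]) auto
qed

text \<open>Colorings injective on \<open>W\<close> are produced injectively from a permutation of
  \<open>W\<close>, followed by a fixed bijection \<open>b\<close> to the colors, together with an
  arbitrary coloring of the other nodes.\<close>

lemma card_colorings_inj_on_ge:
  assumes "finite N" "W \<subseteq> N" "card W = k"
  shows "fact k * k ^ (card N - k) \<le> card {f \<in> N \<rightarrow>\<^sub>E {..<k}. inj_on f W}"
proof -
  have finW: "finite W" using assms finite_subset by blast
  then obtain b where b: "bij_betw b W {..<k}"
    using assms(3) ex_bij_betw_finite_nat[of W] by (auto simp: atLeast0LessThan)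
  let ?P = "{p. p permutes W} \<times> ((N - W) \<rightarrow>\<^sub>E {..<k})"
  let ?G = "\<lambda>(p, h). \<lambda>x. if x \<in> W then b (p x) else h x"
  have "inj_on ?G ?P"
  proof (rule inj_onI, clarify)
    fix p h p' h'
    assume p: "p permutes W" "p' permutes W" and h: "h \<in> (N - W) \<rightarrow>\<^sub>E {..<k}" "h' \<in> (N - W) \<rightarrow>\<^sub>E {..<k}"
      and eq: "(\<lambda>x. if x \<in> W then b (p x) else h x) = (\<lambda>x. if x \<in> W then b (p' x) else h' x)"
    have "p x = p' x" for x
    proof (cases "x \<in> W")
      case True
      then have "b (p x) = b (p' x)" using fun_cong[OF eq, of x] by simp
      then show ?thesis
        using inj_onD[OF bij_betw_imp_inj_on[OF b]] p[THEN permutes_in_image] True by simp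
    next
      case False then show ?thesis using p by (simp add: permutes_def)
    qed
    moreover have "h x = h' x" for x
      using fun_cong[OF eq, of x] h by (cases "x \<in> W") (auto simp: PiE_def extensional_def)
    ultimately show "p = p' \<and> h = h'" by auto
  qed
  moreover have "?G ` ?P \<subseteq> {f \<in> N \<rightarrow>\<^sub>E {..<k}. inj_on f W}"
  proof clarify
    fix p h assume p: "p permutes W" and h: "h \<in> (N - W) \<rightarrow>\<^sub>E {..<k}"
    let ?f = "\<lambda>x. if x \<in> W then b (p x) else h x"
    have "inj_on (b \<circ> p) W"
      using bij_betw_imp_inj_on[OF bij_betw_trans[OF permutes_imp_bij[OF p] b]] .
    then have "inj_on ?f W" by (auto simp: inj_on_def)
    moreover have "b (p x) < k" if "x \<in> W" for x
      using bij_betwE[OF b] permutes_in_image[OF p] that by simp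
    then have "?f \<in> N \<rightarrow>\<^sub>E {..<k}"
      using h assms(2) by (auto simp: PiE_def extensional_def Pi_def)
    ultimately show "?f \<in> N \<rightarrow>\<^sub>E {..<k} \<and> inj_on ?f W" by simp
  qed
  moreover have "finite {f \<in> N \<rightarrow>\<^sub>E {..<k}. inj_on f W}"
    using assms(1) by (simp add: finite_PiE)
  ultimately have "card ?P \<le> card {f \<in> N \<rightarrow>\<^sub>E {..<k}. inj_on f W}"
    using card_inj_on_le by blast
  moreover have "card ?P = fact k * k ^ (card N - k)"
    using assms finW by (simp add: card_cartesian_product card_permutations card_funcsetE card_Diff_subset)
  ultimately show ?thesis by simp
qed

text \<open>\<open>k ^ k / fact k\<close> is a single term of the exponential series at
  \<open>k\<close>.\<close>

lemma power_le_exp_fact: "real k ^ k \<le> exp (real k) * fact k"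
proof -
  have "(\<Sum>i\<in>{k}. real k ^ i /\<^sub>R fact i) \<le> suminf (\<lambda>i. real k ^ i /\<^sub>R fact i)"
    by (rule sum_le_suminf[OF summable_exp_generic]) auto
  then have "real k ^ k / fact k \<le> exp (real k)"
    by (simp add: exp_def divide_inverse mult.commute)
  then show ?thesis by (simp add: field_simps)
qed

text \<open>A fraction of at least \<open>exp (- k)\<close> of all colorings is injective on a given
  \<open>k\<close>-set. The greedy covering with slightly more than \<open>exp k * k * ln n\<close>
  rounds leaves fewer than one of the at most \<open>n ^ k\<close> sets uncovered.\<close>

lemma perfect_hash_family:
  assumes "0 < k" "0 < n"
  shows "\<exists>\<Phi>::(nat \<Rightarrow> nat) set. finite \<Phi> \<and> real (card \<Phi>) \<le> exp (real k) * k * ln n + 1 \<and>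
    (\<forall>f\<in>\<Phi>. f ` {1..n} \<subseteq> {..<k}) \<and> (\<forall>W\<subseteq>{1..n}. card W = k \<longrightarrow> (\<exists>f\<in>\<Phi>. inj_on f W))"
proof -
  let ?F = "{1..n} \<rightarrow>\<^sub>E {..<k}"
  let ?Y = "{W. W \<subseteq> {1..n} \<and> card W = k}"
  let ?r = "exp (- real k)"
  have finF: "finite ?F" by (simp add: finite_PiE)
  have finY: "finite ?Y" by simp
  have neF: "?F \<noteq> {}" using assms by (auto simp: PiE_eq_empty_iff)
  have dense: "?r * card ?F \<le> card {f \<in> ?F. inj_on f W}" if "W \<in> ?Y" for W
  proof -
    have W: "W \<subseteq> {1..n}" "card W = k" using that by auto
    \<comment> \<open>The existence of \<open>W\<close> forces \<open>k \<le> n\<close>; for larger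
      \<open>k\<close> the covering condition is vacuous.\<close>
    have kn: "k \<le> n" using card_mono[OF _ W(1)] W(2) by simp
    have "?r * card ?F = ?r * (real k ^ k * real k ^ (n - k))"
      using kn by (simp add: card_funcsetE power_add[symmetric])
    also have "\<dots> \<le> ?r * (exp (real k) * fact k * real k ^ (n - k))"
      by (intro mult_left_mono mult_right_mono power_le_exp_fact) auto
    also have "\<dots> = real (fact k * k ^ (card {1..n} - k))"
      by (simp add: exp_minus)
    also have "\<dots> \<le> card {f \<in> ?F. inj_on f W}"
      using card_colorings_inj_on_ge[OF _ W] by (simp only: of_nat_le_iff) simp
    finally show ?thesis .
  qed
  define t where "t = exp (real k) * k * ln n"
  \<comment> \<open>The least integer strictly above \<open>t\<close>; strictness is what pushes the
    number of uncovered sets below one.\<close>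
  define q where "q = nat \<lfloor>t\<rfloor> + 1"
  have t: "0 \<le> t" using assms by (simp add: t_def)
  then have q: "t < real q" "real q \<le> t + 1" by (simp_all add: q_def) linarith+
  obtain \<Phi> where \<Phi>: "\<Phi> \<subseteq> ?F" "card \<Phi> \<le> q"
    "card {W \<in> ?Y. \<forall>f\<in>\<Phi>. \<not> inj_on f W} \<le> (1 - ?r) ^ q * card ?Y"
    using greedy_covering[OF finF finY neF, of ?r "\<lambda>f W. inj_on f W" q] dense by auto
  have "(1 - ?r) ^ q \<le> exp (- ?r) ^ q"
    using exp_ge_add_one_self[of "- ?r"] by (intro power_mono) auto
  also have "\<dots> = exp (- ?r * q)" by (simp add: exp_of_nat_mult[symmetric] mult.commute)
  also have "\<dots> < exp (- (k * ln n))"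
  proof -
    have "k * ln n = ?r * t" by (simp add: t_def exp_minus)
    also have "\<dots> < ?r * q" using q by simp
    finally show ?thesis by simp
  qed
  also have "\<dots> = 1 / real n ^ k"
    using assms by (simp add: exp_minus exp_of_nat_mult divide_inverse)
  finally have lt: "(1 - ?r) ^ q < 1 / real n ^ k" .
  have "card ?Y = n choose k" using n_subsets[of "{1..n}" k] by simp
  also have "\<dots> \<le> n ^ k"
    by (rule order_trans[OF _ binomial_fact_pow]) simp
  finally have "card ?Y \<le> n ^ k" .
  then have "(1 - ?r) ^ q * card ?Y \<le> (1 - ?r) ^ q * real (n ^ k)"
    by (intro mult_left_mono) (simp_all only: of_nat_le_iff, simp)
  also have "\<dots> < 1" using lt assms by (simp add: field_simps)
  finally have "card {W \<in> ?Y. \<forall>f\<in>\<Phi>. \<not> inj_on f W} = 0"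
    using \<Phi>(3) by linarith
  then have "{W \<in> ?Y. \<forall>f\<in>\<Phi>. \<not> inj_on f W} = {}" using finY by simp
  moreover have "finite \<Phi>" using \<Phi>(1) finF finite_subset by blast
  moreover have "real (card \<Phi>) \<le> t + 1" using \<Phi>(2) q(2) by linarith
  ultimately show ?thesis using \<Phi>(1) unfolding t_def
    by (intro exI[of _ \<Phi>]) (auto simp: PiE_def Pi_def)
qed

section \<open>Matchings as walks on color sets\<close>

lemma finite_complete_edges [simp]: "finite (complete_edges n)"
  by (simp add: complete_edges_def)

lemma card_Union_matching:
  assumes "M \<subseteq> complete_edges n" "pairwise disjnt M"
  shows "card (\<Union>M) = 2 * card M"
proof -
  have "card (\<Union>M) = (\<Sum>e\<in>M. card e)"
    using assms by (intro card_Union_disjoint) (auto simp: complete_edges_def intro: finite_subset)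
  also have "\<dots> = (\<Sum>e\<in>M. 2)"
    using assms(1) by (intro sum.cong) (auto simp: complete_edges_def)
  finally show ?thesis by simp
qed

lemma char_vec_insert:
  "finite M \<Longrightarrow> e \<notin> M \<Longrightarrow> char_vec (insert e M) = char_vec M + Poly_Mapping.single e 1"
  by (simp add: char_vec_def add.commute)

text \<open>A triple \<open>(f, S, e)\<close> is an arc from \<open>(f, S)\<close> to \<open>(f, S \<union> f ` e)\<close> labelled by the edge \<open>e\<close>.\<close>

definition color_arcs :: "(nat \<Rightarrow> nat) set \<Rightarrow> nat \<Rightarrow> nat \<Rightarrow> ((nat \<Rightarrow> nat) \<times> nat set \<times> nat set) set" where
  "color_arcs \<Phi> k n = {(f, S, e). f \<in> \<Phi> \<and> S \<subseteq> {..<k} \<and> even (card S) \<and>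
     e \<in> complete_edges n \<and> inj_on f e \<and> f ` e \<inter> S = {}}"

lemma color_arcs_subset: "color_arcs \<Phi> k n \<subseteq> \<Phi> \<times> Pow {..<k} \<times> complete_edges n"
  by (auto simp: color_arcs_def)

lemma finite_color_arcs: "finite \<Phi> \<Longrightarrow> finite (color_arcs \<Phi> k n)"
  by (rule finite_subset[OF color_arcs_subset]) simp

lemma card_color_arcs_le:
  "finite \<Phi> \<Longrightarrow> card (color_arcs \<Phi> k n) \<le> card \<Phi> * 2 ^ k * card (complete_edges n)"
  using card_mono[OF _ color_arcs_subset, of \<Phi> k n] by (simp add: card_cartesian_product card_Pow)

text \<open>The coloring in a node never changes along a walk, so each walk lives in the network of
  one \<open>f\<close>. Disjoint color sets force disjoint edges, so walks to level \<open>l\<close>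
  give matchings of size \<open>l\<close>; conversely, the hash property provides for each matching
  a coloring under which its edges form a walk.\<close>

lemma match_polytope_extension:
  assumes fin: "finite \<Phi>" and range: "\<And>f. f \<in> \<Phi> \<Longrightarrow> f ` {1..n} \<subseteq> {..<2 * l}"
    and hash: "\<And>W. W \<subseteq> {1..n} \<Longrightarrow> card W = 2 * l \<Longrightarrow> \<exists>f\<in>\<Phi>. inj_on f W" and "0 < l"
  shows "\<exists>d Q p. is_extension d Q p (complete_edges n) (match_polytope l n) \<and>
    extension_size Q \<le> card \<Phi> * 2 ^ (2 * l) * card (complete_edges n) \<and>
    (\<forall>C\<ge>4. extension_enc_bounded C d Q p (complete_edges n))"
proof -
  let ?A = "color_arcs \<Phi> (2 * l) n"
  define d where "d = card ?A"
  obtain g where g: "bij_betw g {..<d} ?A"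
    using ex_bij_betw_nat_finite[OF finite_color_arcs[OF fin]] unfolding d_def atLeast0LessThan
    by blast
  define src where "src = (\<lambda>(f, S, e). (f, S)) \<circ> g"
  define tgt where "tgt = (\<lambda>(f, S, e). (f, S \<union> f ` e)) \<circ> g"
  define lab where "lab = (\<lambda>(f, S, e). Poly_Mapping.single e (1::real)) \<circ> g"
  \<comment> \<open>Each edge adds two colors. Since \<open>color_arcs\<close> admits only even
    color sets, a source on level 0 has the empty set of colors.\<close>
  define level where "level = (\<lambda>(f :: nat \<Rightarrow> nat, S :: nat set). card S div 2)"
  have arc: "\<exists>f S e. (f, S, e) \<in> ?A \<and> src i = (f, S) \<and> tgt i = (f, S \<union> f ` e) \<and>
      lab i = Poly_Mapping.single e 1" if "i < d" for i
  proof -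
    obtain f S e where "g i = (f, S, e)" by (cases "g i")
    moreover have "g i \<in> ?A" using bij_betwE[OF g] that by simp
    ultimately show ?thesis
      by (intro exI[of _ f] exI[of _ S] exI[of _ e]) (simp add: src_def tgt_def lab_def)
  qed
  have arc_ex: "\<exists>i<d. src i = (f, S) \<and> tgt i = (f, S \<union> f ` e) \<and> lab i = Poly_Mapping.single e 1"
    if fSe: "(f, S, e) \<in> ?A" for f S e
  proof -
    obtain i where "i < d" "g i = (f, S, e)"
      using fSe bij_betw_imp_surj_on[OF g] by (metis imageE lessThan_iff)
    then show ?thesis by (auto simp: src_def tgt_def lab_def)
  qed
  have card_target: "card (S \<union> f ` e) = card S + 2" "card S + 2 \<le> 2 * l"
    if "(f, S, e) \<in> ?A" for f S e
  proof -
    have *: "S \<subseteq> {..<2 * l}" "e \<subseteq> {1..n}" "card e = 2" "inj_on f e" "f ` e \<inter> S = {}" "f \<in> \<Phi>"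
      using that by (auto simp: color_arcs_def complete_edges_def)
    have finS: "finite S" and fine: "finite e"
      using *(1,2) by (auto intro: finite_subset)
    show c: "card (S \<union> f ` e) = card S + 2"
      using * finS fine by (subst card_Un_disjoint) (auto simp: card_image)
    have "S \<union> f ` e \<subseteq> {..<2 * l}" using range[OF *(6)] *(1,2) by blast
    then show "card S + 2 \<le> 2 * l"
      using card_mono[of "{..<2 * l}" "S \<union> f ` e"] c by simp
  qed
  interpret layered_network d l src tgt lab level
  proof
    fix i assume "i < d"
    then obtain f S e where i: "(f, S, e) \<in> ?A" "src i = (f, S)" "tgt i = (f, S \<union> f ` e)"
      using arc by blast
    show "level (tgt i) = Suc (level (src i))" "level (src i) < l"
      using i card_target[OF i(1)] by (auto simp: level_def)
  qed (use \<open>0 < l\<close> in simp)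
  \<comment> \<open>The color set of the end node is exactly the set of colors of the nodes matched
    so far, so an edge whose colors are new meets none of the earlier edges.\<close>
  have matching_of_walk: "\<exists>f\<in>\<Phi>. \<exists>M\<subseteq>complete_edges n. pairwise disjnt M \<and> inj_on f (\<Union>M) \<and>
      v = (f, f ` \<Union>M) \<and> w = char_vec M" if "walk v w" for v w
    using that
  proof (induction rule: walk.induct)
    case (start i)
    then obtain f S e where i: "(f, S, e) \<in> ?A" "src i = (f, S)" using arc by blast
    have "even (card S)" "S \<subseteq> {..<2 * l}" "f \<in> \<Phi>" using i(1) by (auto simp: color_arcs_def)
    moreover have "card S div 2 = 0" using start(2) i(2) by (simp add: level_def)
    ultimately have "S = {}"
      using finite_subset[of S "{..<2 * l}"] by (auto elim!: evenE)
    then show ?case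
      using i(2) \<open>f \<in> \<Phi>\<close> by (intro bexI[of _ f] exI[of _ "{}"]) (auto simp: char_vec_def)
  next
    case (step i w)
    then obtain f M where M: "f \<in> \<Phi>" "M \<subseteq> complete_edges n" "pairwise disjnt M" "inj_on f (\<Union>M)"
      "src i = (f, f ` \<Union>M)" "w = char_vec M" by blast
    obtain e where e: "(f, f ` \<Union>M, e) \<in> ?A" "tgt i = (f, f ` \<Union>M \<union> f ` e)"
      "lab i = Poly_Mapping.single e 1"
      using arc[OF step(2)] M(5) by auto
    have e': "e \<in> complete_edges n" "inj_on f e" "f ` e \<inter> f ` \<Union>M = {}"
      using e(1) by (auto simp: color_arcs_def)
    have disj: "e \<inter> \<Union>M = {}" using e'(3) by blast
    have "e \<noteq> {}" using e'(1) by (auto simp: complete_edges_def)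
    then have "e \<notin> M" using disj by blast
    have "pairwise disjnt (insert e M)"
      using M(3) disj by (auto simp: pairwise_insert disjnt_def)
    moreover have "inj_on f (\<Union>(insert e M))"
      using e' M(4) by (simp add: inj_on_Un) blast
    moreover have "finite M" using M(2) by (rule finite_subset) simp
    then have "char_vec (insert e M) = w + lab i"
      using \<open>e \<notin> M\<close> M(6) e(3) by (simp add: char_vec_insert)
    moreover have "tgt i = (f, f ` \<Union>(insert e M))" using e(2) by auto
    ultimately show ?case
      using M(1,2) e'(1) by (intro bexI[of _ f] exI[of _ "insert e M"]) auto
  qed
  \<comment> \<open>The edges of \<open>M\<close> may be added in any order, so the induction runs
    over arbitrary subsets \<open>N\<close> of \<open>M\<close>.\<close>
  have walk_of_matching: "walk (f, f ` \<Union>N) (char_vec N)"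
    if f: "f \<in> \<Phi>" and M: "M \<in> matchings l n" "inj_on f (\<Union>M)" and N: "N \<subseteq> M" for f M N
  proof -
    have M': "M \<subseteq> complete_edges n" "pairwise disjnt M" "card M = l"
      using M(1) by (auto simp: matchings_def)
    have arcs: "(f, f ` \<Union>N, e) \<in> ?A" if "N \<subseteq> M" "e \<in> M" "e \<notin> N" for N e
    proof -
      have "\<Union>N \<subseteq> \<Union>M" "e \<subseteq> \<Union>M" using that by auto
      then have inj: "inj_on f (\<Union>N)" "inj_on f e" by (auto intro: inj_on_subset[OF M(2)])
      have "disjnt e e'" if "e' \<in> N" for e'
        using pairwiseD[OF M'(2), of e e'] that \<open>N \<subseteq> M\<close> \<open>e \<in> M\<close> \<open>e \<notin> N\<close> by auto
      then have "e \<inter> \<Union>N = {}" by (auto simp: disjnt_def)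
      then have "f ` e \<inter> f ` \<Union>N = {}"
        using inj_on_image_Int[OF M(2) \<open>e \<subseteq> \<Union>M\<close> \<open>\<Union>N \<subseteq> \<Union>M\<close>] by simp
      moreover have "even (card (f ` \<Union>N))"
        using card_Union_matching[of N n] M' that(1) inj(1)
        by (simp add: card_image pairwise_subset[OF M'(2)])
      moreover have "f ` \<Union>N \<subseteq> {..<2 * l}"
      proof -
        have "\<Union>N \<subseteq> {1..n}" using that(1) M'(1) by (auto simp: complete_edges_def)
        then show ?thesis using range[OF f] by blast
      qed
      ultimately show ?thesis
        using f inj(2) that(2) M'(1) by (auto simp: color_arcs_def)
    qed
    have "finite N" using N M'(1) by (meson finite_complete_edges finite_subset)
    then show ?thesis using N
    proof (induction N rule: finite_induct)
      case empty
      \<comment> \<open>The empty walk has to start at the source of an arc; an edge of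
        \<open>M\<close>, present because \<open>0 < l\<close>, provides one leaving
        \<open>(f, {})\<close>.\<close>
      obtain e where "e \<in> M" using M'(3) \<open>0 < l\<close> by fastforce
      then obtain i where "i < d" "src i = (f, {})"
        using arc_ex[OF arcs[of "{}" e]] by auto
      then show ?case
        using walk.start[of i] by (simp add: level_def char_vec_def)
    next
      case (insert e N)
      then obtain i where "i < d" "src i = (f, f ` \<Union>N)" "tgt i = (f, f ` \<Union>N \<union> f ` e)"
        "lab i = Poly_Mapping.single e 1"
        using arc_ex[OF arcs[of N e]] by auto
      then show ?case
        using walk.step[of i "char_vec N"] insert by (simp add: char_vec_insert image_Un Un_commute)
    qed
  qed
  have "{w. \<exists>v. level v = l \<and> walk v w} = char_vec ` matchings l n"
  proof (intro equalityI subsetI)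
    fix w assume "w \<in> {w. \<exists>v. level v = l \<and> walk v w}"
    then obtain f M where M: "M \<subseteq> complete_edges n" "pairwise disjnt M" "inj_on f (\<Union>M)"
      "level (f, f ` \<Union>M) = l" "w = char_vec M"
      using matching_of_walk by blast
    then have "card M = l"
      using card_Union_matching[OF M(1,2)] by (simp add: level_def card_image)
    then show "w \<in> char_vec ` matchings l n"
      using M by (auto simp: matchings_def)
  next
    fix w assume "w \<in> char_vec ` matchings l n"
    then obtain M where M: "M \<in> matchings l n" "w = char_vec M" by auto
    have card: "card (\<Union>M) = 2 * l"
      using M(1) card_Union_matching[of M n] by (simp add: matchings_def)
    moreover have "\<Union>M \<subseteq> {1..n}" using M(1) by (auto simp: matchings_def complete_edges_def)
    ultimately obtain f where f: "f \<in> \<Phi>" "inj_on f (\<Union>M)" using hash[of "\<Union>M"] by auto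
    have "walk (f, f ` \<Union>M) w" using walk_of_matching[OF f(1) M(1) f(2) order_refl] M(2) by simp
    moreover have "level (f, f ` \<Union>M) = l" using card f(2) by (simp add: level_def card_image)
    ultimately show "w \<in> {w. \<exists>v. level v = l \<and> walk v w}" by blast
  qed
  moreover have "lab i \<in> coord_space (complete_edges n)" if "i < d" for i
    using arc[OF that] by (auto simp: coord_space_def color_arcs_def)
  ultimately have "is_extension d flows project (complete_edges n) (match_polytope l n)"
    using is_extension_flows[of "complete_edges n"] by (simp add: match_polytope_def)
  moreover have "extension_size flows \<le> card \<Phi> * 2 ^ (2 * l) * card (complete_edges n)"
    using extension_size_flows card_color_arcs_le[OF fin, of "2 * l" n] by (simp add: d_def)
  moreover have "Poly_Mapping.lookup (lab i) j \<in> {0, 1}" if "i < d" for i j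
    using arc[OF that] by (auto simp: lookup_single when_def)
  then have "\<forall>C\<ge>4. extension_enc_bounded C d flows project (complete_edges n)"
    using enc_bounded_flows by blast
  ultimately show ?thesis by blast
qed

text \<open>The exponent 7 arises from \<open>exp 2 \<le> 8\<close>,
  \<open>2 * l + 2 \<le> 4 ^ l\<close> and \<open>2 ^ (2 * l) = 4 ^ l\<close>, since
  \<open>8 * 4 * 4 = 2 ^ 7\<close>.\<close>

lemma perfect_hash_size_bound:
  assumes "2 \<le> n" "0 < l"
  shows "(exp (real (2 * l)) * real (2 * l) * ln n + 1) * 2 ^ (2 * l) * (real n)\<^sup>2
    \<le> 2 powr (7 * real l) * (real n)\<^sup>2 * ln n"
proof -
  \<comment> \<open>With \<open>n \<ge> 2\<close>, the summand 1 is at most \<open>2 * ln n\<close>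
    and is absorbed into the logarithmic term.\<close>
  have "ln 2 \<le> ln (real n)" using assms by simp
  then have ln: "1 \<le> 2 * ln (real n)" using ln2_ge_two_thirds by linarith
  have "exp (1::real) \<le> 2.72"
    using e_approx_32 by (simp add: abs_if split: if_splits)
  then have "exp (1::real) ^ 2 \<le> 2.72 ^ 2" by (intro power_mono) auto
  then have "exp (1::real) ^ 2 \<le> 8" by (simp add: power2_eq_square)
  then have "(exp (1::real) ^ 2) ^ l \<le> 8 ^ l" by (intro power_mono) auto
  then have e: "exp (real (2 * l)) \<le> 8 ^ l"
    by (metis exp_of_nat_mult mult.right_neutral power_mult)
  have l: "2 * real l + 2 \<le> 4 ^ l"
    using assms(2)
  proof (induction l rule: nat_induct_non_zero)
    case (Suc l)
    then show ?case by simp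
  qed simp
  have "exp (real (2 * l)) * real (2 * l) * ln n + 1 \<le> 8 ^ l * real (2 * l) * ln n + 2 * ln n"
    using e ln assms by (intro add_mono mult_right_mono) auto
  also have "\<dots> \<le> 8 ^ l * real (2 * l) * ln n + 8 ^ l * (2 * ln n)"
    using ln by simp
  also have "\<dots> = 8 ^ l * (2 * real l + 2) * ln n" by (simp add: algebra_simps)
  also have "\<dots> \<le> 8 ^ l * 4 ^ l * ln n"
    using l ln by (intro mult_left_mono mult_right_mono) auto
  finally have "(exp (real (2 * l)) * real (2 * l) * ln n + 1) * 2 ^ (2 * l) * (real n)\<^sup>2
      \<le> (8 ^ l * 4 ^ l * ln n) * 2 ^ (2 * l) * (real n)\<^sup>2"
    by (intro mult_right_mono) auto
  also have "\<dots> = (8 * 4 * 4) ^ l * (real n)\<^sup>2 * ln n"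
    unfolding power_mult_distrib power_mult by simp
  also have "(8 * 4 * 4 :: real) ^ l = 2 powr (7 * real l)"
    by (simp add: powr_powr[symmetric] powr_realpow)
  finally show ?thesis .
qed

theorem theorem22:
  shows "\<exists>C::real. C > 0 \<and> (\<forall>n l :: nat. n > 0 \<longrightarrow> l > 0 \<longrightarrow>
    (\<exists>d Q p. is_extension d Q p (complete_edges n) (match_polytope l n) \<and>
       real (extension_size Q) \<le> 2 powr (C * real l) * (real n)\<^sup>2 * ln (real n) \<and>
       extension_enc_bounded C d Q p (complete_edges n)))"
proof (rule exI[of _ 7], intro conjI allI impI)
  \<comment> \<open>The constant 7 is the exponent in \<open>perfect_hash_size_bound\<close>, and it
    also exceeds the encoding bound 4.\<close>
  fix n l :: nat assume n: "0 < n" and l: "0 < l"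
  obtain \<Phi> :: "(nat \<Rightarrow> nat) set" where \<Phi>: "finite \<Phi>"
    "real (card \<Phi>) \<le> exp (real (2 * l)) * real (2 * l) * ln n + 1"
    "\<And>f. f \<in> \<Phi> \<Longrightarrow> f ` {1..n} \<subseteq> {..<2 * l}"
    "\<And>W. W \<subseteq> {1..n} \<Longrightarrow> card W = 2 * l \<Longrightarrow> \<exists>f\<in>\<Phi>. inj_on f W"
    using perfect_hash_family[of "2 * l" n] n l by auto
  obtain d Q and p :: "(nat \<Rightarrow>\<^sub>0 real) \<Rightarrow> (nat set \<Rightarrow>\<^sub>0 real)"
    where ext: "is_extension d Q p (complete_edges n) (match_polytope l n)"
    and size: "extension_size Q \<le> card \<Phi> * 2 ^ (2 * l) * card (complete_edges n)"
    and enc: "\<forall>C\<ge>4. extension_enc_bounded C d Q p (complete_edges n)"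
    using match_polytope_extension[OF \<Phi>(1,3,4) l] by blast
  have edges: "card (complete_edges n) = n choose 2"
    using n_subsets[of "{1..n}" 2] by (simp add: complete_edges_def)
  have "real (extension_size Q) \<le> 2 powr (7 * real l) * (real n)\<^sup>2 * ln (real n)"
  \<comment> \<open>Here \<open>ln n = 0\<close>, so the bound demands size zero; it holds because
    the graph has no edges and hence the network has no arcs.\<close>
  proof (cases "n = 1")
    case True
    then show ?thesis using size edges by (simp add: numeral_2_eq_2)
  next
    case False
    have "n choose 2 \<le> n ^ 2"
      by (rule order_trans[OF _ binomial_fact_pow]) simp
    then have "extension_size Q \<le> card \<Phi> * 2 ^ (2 * l) * n ^ 2"
      using size unfolding edges by (meson mult_le_mono2 order_trans)
    then have "real (extension_size Q) \<le> real (card \<Phi>) * 2 ^ (2 * l) * (real n)\<^sup>2"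
      by (metis (mono_tags, lifting) of_nat_le_iff of_nat_mult of_nat_numeral of_nat_power)
    also have "\<dots> \<le> (exp (real (2 * l)) * real (2 * l) * ln n + 1) * 2 ^ (2 * l) * (real n)\<^sup>2"
      using \<Phi>(2) by (intro mult_right_mono) auto
    also have "\<dots> \<le> 2 powr (7 * real l) * (real n)\<^sup>2 * ln n"
      using False n l by (intro perfect_hash_size_bound) auto
    finally show ?thesis .
  qed
  then show "\<exists>d Q p. is_extension d Q p (complete_edges n) (match_polytope l n) \<and>
       real (extension_size Q) \<le> 2 powr (7 * real l) * (real n)\<^sup>2 * ln (real n) \<and>
       extension_enc_bounded 7 d Q p (complete_edges n)"
    using ext enc by (intro exI[of _ d] exI[of _ Q] exI[of _ p]) auto
qed simp

end
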